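(* Let $\alpha,\beta,\gamma\in\mathbb{R}$ with $\gamma\neq 0$. Let $(G_2,g)$ be the connected, simply connected three-dimensional Lie group with left-invariant Lorentzian metric $g$ whose Lie algebra has a pseudo-orthonormal basis $\{e_1,e_2,e_3\}$ with $e_3$ timelike satisfying $$[e_1,e_2]=\gamma e_2-\beta e_3,\quad [e_1,e_3]=-\beta e_2-\gamma e_3,\quad [e_2,e_3]=\alpha e_1.$$ Then $(G_2,g)$ is an $Ein(2)$ manifold with scalars $\lambda_1,\lambda_2$ if and only if $\alpha=2\beta$, $\gamma\neq 0$, $\lambda_1=\frac{\alpha^2}{2}+2\gamma^2$ and $\lambda_2=0$.
   Context: Pseudo-orthonormal basis with $e_3$ timelike means: the $e_i$ are left-invariant vector fields with $g(e_1,e_1)=g(e_2,e_2)=1$, $g(e_3,e_3)=-1$, $g(e_i,e_j)=0$ for $i\ne j$. Let $\nabla$ be the Levi-Civita connection of $g$, with curvature $R(X,Y)Z=\nabla_X\nabla_YZ-\nabla_Y\nabla_XZ-\nabla_{[X,Y]}Z$. The Ricci tensor is $\rho(X,Y)=-g(R(X,e_1)Y,e_1)-g(R(X,e_2)Y,e_2)+g(R(X,e_3)Y,e_3)$, and the Ricci operator $\rho^0$ is defined by $\rho(X,Y)=g(\rho^0(X),Y)$. The symmetric $(0,2)$-tensor $\rho^2$ is defined by $\rho^2(X,Y)=\rho(\rho^0X,Y)=g(\rho^0(X),\rho^0(Y))$. The manifold is called $Ein(2)$ (with scalars $\lambda_1,\lambda_2$) if $\rho^2+\lambda_1\rho+\lambda_2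 g=0$ for scalars $\lambda_1,\lambda_2$. *)

theory Defs
  imports "HOL-Analysis.Analysis" "HOL-Library.Function_Algebras"
begin

text \<open>
  Real-valued functions, tangent vectors and vector fields are all functions into a real vector
  space, so the pointwise vector space structure makes the notions \<open>span\<close> and \<open>independent\<close>
  available for them.
\<close>

instantiation "fun" :: (type, real_vector) real_vector
begin

definition scaleR_fun :: "real \<Rightarrow> ('a \<Rightarrow> 'b) \<Rightarrow> 'a \<Rightarrow> 'b" where
  "scaleR_fun c f = (\<lambda>x. c *\<^sub>R f x)"

instance
  by standard (simp_all add: scaleR_fun_def plus_fun_def fun_eq_iff scaleR_add_right scaleR_add_left)

end

text \<open>For open \<open>S\<close> in a Euclidean space, \<open>Ck_on k S f\<close> says that \<open>f\<close> is of class \<open>C\<^sup>k\<close> on \<open>S\<close>.\<close>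

primrec Ck_on :: "nat \<Rightarrow> 'b::euclidean_space set \<Rightarrow> ('b \<Rightarrow> 'c::real_normed_vector) \<Rightarrow> bool" where
  "Ck_on 0 S f \<longleftrightarrow> continuous_on S f"
| "Ck_on (Suc k) S f \<longleftrightarrow> (\<forall>x\<in>S. f differentiable (at x)) \<and>
     (\<forall>v. Ck_on k S (\<lambda>x. frechet_derivative f (at x) v))"

definition smooth_on :: "'b::euclidean_space set \<Rightarrow> ('b \<Rightarrow> 'c::real_normed_vector) \<Rightarrow> bool" where
  "smooth_on S f \<longleftrightarrow> (\<forall>k. Ck_on k S f)"

type_synonym 'a chart = "'a set \<times> ('a \<Rightarrow> real^3)"

definition smooth_atlas :: "'a::topological_space chart set \<Rightarrow> bool" where
  "smooth_atlas A \<longleftrightarrow>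
     (\<forall>(U, \<phi>)\<in>A. open U \<and> open (\<phi> ` U) \<and> homeomorphism U (\<phi> ` U) \<phi> (inv_into U \<phi>)) \<and>
     (\<Union>(U, \<phi>)\<in>A. U) = UNIV \<and>
     (\<forall>(U, \<phi>)\<in>A. \<forall>(V, \<psi>)\<in>A. smooth_on (\<phi> ` (U \<inter> V)) (\<lambda>x. \<psi> (inv_into U \<phi> x)))"

definition smooth_functions :: "'a chart set \<Rightarrow> ('a \<Rightarrow> real) set" where
  "smooth_functions A = {f. \<forall>(U, \<phi>)\<in>A. smooth_on (\<phi> ` U) (\<lambda>x. f (inv_into U \<phi> x))}"

text \<open>
  The group is written additively, since the type class of topological groups is additive; it is
  not assumed to be commutative. Continuity of the group operations is part of that class and makes
  the sets on which smoothness is required below open.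
\<close>

definition lie_group ::
    "'a::{topological_group_add, t2_space, second_countable_topology} chart set \<Rightarrow> bool" where
  "lie_group A \<longleftrightarrow> smooth_atlas A \<and>
     (\<forall>(U, \<phi>)\<in>A. \<forall>(V, \<psi>)\<in>A. \<forall>(W, \<xi>)\<in>A.
        smooth_on {(x, y) \<in> \<phi> ` U \<times> \<psi> ` V. inv_into U \<phi> x + inv_into V \<psi> y \<in> W}
          (\<lambda>(x, y). \<xi> (inv_into U \<phi> x + inv_into V \<psi> y))) \<and>
     (\<forall>(U, \<phi>)\<in>A. \<forall>(V, \<psi>)\<in>A.
        smooth_on {x \<in> \<phi> ` U. - inv_into U \<phi> x \<in> V} (\<lambda>x. \<psi> (- inv_into U \<phi> x)))"

text \<open>
  Tangent vectors at \<open>p\<close> are the derivations at \<open>p\<close> of the algebra of smooth functions. As functionals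
  on all functions they are extended by 0, so that equality of derivations is equality in HOL.
\<close>

type_synonym 'a tangent_vector = "('a \<Rightarrow> real) \<Rightarrow> real"
type_synonym 'a vector_field = "'a \<Rightarrow> 'a tangent_vector"
type_synonym 'a tensor2 = "'a \<Rightarrow> 'a tangent_vector \<Rightarrow> 'a tangent_vector \<Rightarrow> real"

definition tangent_space :: "'a chart set \<Rightarrow> 'a \<Rightarrow> 'a tangent_vector set" where
  "tangent_space A p = {D.
     (\<forall>f\<in>smooth_functions A. \<forall>h\<in>smooth_functions A.
        D (f + h) = D f + D h \<and> D (f * h) = f p * D h + h p * D f) \<and>
     (\<forall>f\<in>smooth_functions A. \<forall>c. D (c *\<^sub>R f) = c * D f) \<and>
     (\<forall>f. f \<notin> smooth_functions A \<longrightarrow> D f = 0)}"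

definition vector_fields :: "'a chart set \<Rightarrow> 'a vector_field set" where
  "vector_fields A = {X. (\<forall>p. X p \<in> tangent_space A p) \<and>
     (\<forall>f\<in>smooth_functions A. (\<lambda>p. X p f) \<in> smooth_functions A)}"

definition fscale :: "('a \<Rightarrow> real) \<Rightarrow> 'a vector_field \<Rightarrow> 'a vector_field" where
  "fscale f X = (\<lambda>p. f p *\<^sub>R X p)"

definition lie_bracket :: "'a vector_field \<Rightarrow> 'a vector_field \<Rightarrow> 'a vector_field" where
  "lie_bracket X Y = (\<lambda>p f. X p (\<lambda>q. Y q f) - Y p (\<lambda>q. X q f))"

text \<open>The differential of the left translation \<open>x \<mapsto> a + x\<close>.\<close>

definition left_translate :: "'a::group_add \<Rightarrow> 'a tangent_vector \<Rightarrow> 'a tangent_vector" where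
  "left_translate a D = (\<lambda>f. D (\<lambda>x. f (a + x)))"

definition lie_algebra :: "'a::group_add chart set \<Rightarrow> 'a vector_field set" where
  "lie_algebra A = {X \<in> vector_fields A. \<forall>a p. X (a + p) = left_translate a (X p)}"

definition pseudo_orthonormal ::
    "('v \<Rightarrow> 'v \<Rightarrow> real) \<Rightarrow> 'v \<Rightarrow> 'v \<Rightarrow> 'v \<Rightarrow> bool" where
  "pseudo_orthonormal B v1 v2 v3 \<longleftrightarrow>
     B v1 v1 = 1 \<and> B v2 v2 = 1 \<and> B v3 v3 = - 1 \<and>
     B v1 v2 = 0 \<and> B v2 v1 = 0 \<and> B v1 v3 = 0 \<and> B v3 v1 = 0 \<and> B v2 v3 = 0 \<and> B v3 v2 = 0"

text \<open>
  The values of \<open>g p\<close> outside the tangent space at \<open>p\<close> are irrelevant. The third conjunct is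
  nondegeneracy together with signature \<open>(+,+,-)\<close>.
\<close>

definition lorentzian_metric :: "'a chart set \<Rightarrow> 'a tensor2 \<Rightarrow> bool" where
  "lorentzian_metric A g \<longleftrightarrow>
     (\<forall>p. \<forall>u\<in>tangent_space A p. \<forall>v\<in>tangent_space A p. g p u v = g p v u) \<and>
     (\<forall>p. \<forall>u\<in>tangent_space A p. \<forall>v\<in>tangent_space A p. \<forall>w\<in>tangent_space A p. \<forall>c.
        g p (u + v) w = g p u w + g p v w \<and> g p (c *\<^sub>R u) w = c * g p u w) \<and>
     (\<forall>p. \<exists>v1 v2 v3. independent {v1, v2, v3} \<and> span {v1, v2, v3} = tangent_space A p \<and>
        pseudo_orthonormal (g p) v1 v2 v3) \<and>
     (\<forall>X\<in>vector_fields A. \<forall>Y\<in>vector_fields A. (\<lambda>p. g p (X p) (Y p)) \<in> smooth_functions A)"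

definition left_invariant_metric :: "'a::group_add chart set \<Rightarrow> 'a tensor2 \<Rightarrow> bool" where
  "left_invariant_metric A g \<longleftrightarrow>
     (\<forall>a p. \<forall>u\<in>tangent_space A p. \<forall>v\<in>tangent_space A p.
        g (a + p) (left_translate a u) (left_translate a v) = g p u v)"

definition affine_connection ::
    "'a chart set \<Rightarrow> ('a vector_field \<Rightarrow> 'a vector_field \<Rightarrow> 'a vector_field) \<Rightarrow> bool" where
  "affine_connection A nab \<longleftrightarrow>
     (\<forall>X\<in>vector_fields A. \<forall>Y\<in>vector_fields A. nab X Y \<in> vector_fields A) \<and>
     (\<forall>X\<in>vector_fields A. \<forall>Y\<in>vector_fields A. \<forall>Z\<in>vector_fields A.
        nab (X + Y) Z = nab X Z + nab Y Z \<and> nab X (Y + Z) = nab X Y + nab X Z) \<and>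
     (\<forall>X\<in>vector_fields A. \<forall>Y\<in>vector_fields A. \<forall>f\<in>smooth_functions A.
        nab (fscale f X) Y = fscale f (nab X Y) \<and>
        nab X (fscale f Y) = fscale (\<lambda>p. X p f) Y + fscale f (nab X Y))"

definition levi_civita_connection ::
    "'a chart set \<Rightarrow> 'a tensor2 \<Rightarrow> ('a vector_field \<Rightarrow> 'a vector_field \<Rightarrow> 'a vector_field) \<Rightarrow> bool" where
  "levi_civita_connection A g nab \<longleftrightarrow> affine_connection A nab \<and>
     (\<forall>X\<in>vector_fields A. \<forall>Y\<in>vector_fields A. nab X Y - nab Y X = lie_bracket X Y) \<and>
     (\<forall>X\<in>vector_fields A. \<forall>Y\<in>vector_fields A. \<forall>Z\<in>vector_fields A. \<forall>p.
        X p (\<lambda>q. g q (Y q) (Z q)) = g p (nab X Y p) (Z p) + g p (Y p) (nab X Z p))"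

definition curvature ::
    "('a vector_field \<Rightarrow> 'a vector_field \<Rightarrow> 'a vector_field) \<Rightarrow>
     'a vector_field \<Rightarrow> 'a vector_field \<Rightarrow> 'a vector_field \<Rightarrow> 'a vector_field" where
  "curvature nab X Y Z = nab X (nab Y Z) - nab Y (nab X Z) - nab (lie_bracket X Y) Z"

text \<open>
  In what follows \<open>(e1, e2, e3)\<close> is a pseudo-orthonormal frame with \<open>e3\<close> timelike, and \<open>nab\<close> is
  the Levi-Civita connection of \<open>g\<close>.
\<close>

definition ricci ::
    "'a tensor2 \<Rightarrow> ('a vector_field \<Rightarrow> 'a vector_field \<Rightarrow> 'a vector_field) \<Rightarrow>
     'a vector_field \<Rightarrow> 'a vector_field \<Rightarrow> 'a vector_field \<Rightarrow>
     'a vector_field \<Rightarrow> 'a vector_field \<Rightarrow> 'a \<Rightarrow> real" where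
  "ricci g nab e1 e2 e3 X Y = (\<lambda>p.
     - g p (curvature nab X e1 Y p) (e1 p)
     - g p (curvature nab X e2 Y p) (e2 p)
     + g p (curvature nab X e3 Y p) (e3 p))"

definition ricci_operator ::
    "'a chart set \<Rightarrow> 'a tensor2 \<Rightarrow> ('a vector_field \<Rightarrow> 'a vector_field \<Rightarrow> 'a vector_field) \<Rightarrow>
     'a vector_field \<Rightarrow> 'a vector_field \<Rightarrow> 'a vector_field \<Rightarrow> 'a vector_field \<Rightarrow> 'a vector_field" where
  "ricci_operator A g nab e1 e2 e3 X = (THE Z. Z \<in> vector_fields A \<and>
     (\<forall>Y\<in>vector_fields A. \<forall>p. ricci g nab e1 e2 e3 X Y p = g p (Z p) (Y p)))"

definition ricci2 ::
    "'a chart set \<Rightarrow> 'a tensor2 \<Rightarrow> ('a vector_field \<Rightarrow> 'a vector_field \<Rightarrow> 'a vector_field) \<Rightarrow>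
     'a vector_field \<Rightarrow> 'a vector_field \<Rightarrow> 'a vector_field \<Rightarrow>
     'a vector_field \<Rightarrow> 'a vector_field \<Rightarrow> 'a \<Rightarrow> real" where
  "ricci2 A g nab e1 e2 e3 X Y =
     ricci g nab e1 e2 e3 (ricci_operator A g nab e1 e2 e3 X) Y"

definition Ein2 ::
    "'a chart set \<Rightarrow> 'a tensor2 \<Rightarrow> ('a vector_field \<Rightarrow> 'a vector_field \<Rightarrow> 'a vector_field) \<Rightarrow>
     'a vector_field \<Rightarrow> 'a vector_field \<Rightarrow> 'a vector_field \<Rightarrow> real \<Rightarrow> real \<Rightarrow> bool" where
  "Ein2 A g nab e1 e2 e3 l1 l2 \<longleftrightarrow>
     (\<forall>X\<in>vector_fields A. \<forall>Y\<in>vector_fields A. \<forall>p.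
        ricci2 A g nab e1 e2 e3 X Y p + l1 * ricci g nab e1 e2 e3 X Y p
          + l2 * g p (X p) (Y p) = 0)"

end

theory Submission
  imports Defs
begin

text \<open>
  The \<open>Ein(2)\<close> condition is tensorial, so it can be tested on the left-invariant frame, where it
  becomes a polynomial identity for the Ricci operator. Every vector field is a combination of
  \<open>e1, e2, e3\<close> with smooth coefficients (\<open>vector_field_expand\<close>), and the Ricci tensor is
  bilinear over the smooth functions (\<open>ricci_add\<close>, \<open>ricci_fscale\<close>); hence everything is
  determined by the constants \<open>\<rho>(e\<^sub>i, e\<^sub>j)\<close>.

  The inner products of the frame fields are constant, so the Koszul formula (\<open>koszul\<close>) expresses
  the Levi-Civita connection on the frame through the brackets alone (\<open>nab_table\<close>). With
  \<open>a = - (\<alpha>\<^sup>2 / 2 + 2 \<gamma>\<^sup>2)\<close>, \<open>b = \<alpha> (\<alpha> - 2 \<beta>) / 2\<close> and \<open>c = \<gamma> (2 \<beta> - \<alpha>)\<close>, the Ricci operator then has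
  \<open>e1\<close> as an eigenvector with eigenvalue \<open>a\<close> and acts on \<open>e2, e3\<close> by
  \<open>e2 \<mapsto> b e2 - c e3\<close>, \<open>e3 \<mapsto> c e2 + b e3\<close> (\<open>ricci_table\<close>, \<open>ricci_operator_components\<close>). Its
  eigenvalues are \<open>a\<close> and \<open>b \<plusminus> i c\<close>, and the \<open>Ein(2)\<close> equation says that
  \<open>t\<^sup>2 + \<lambda>\<^sub>1 t + \<lambda>\<^sub>2\<close> annihilates it (\<open>Ein2_iff\<close>).

  If \<open>c \<noteq> 0\<close>, the eigenvalues are one real number and two conjugate non-real ones, so no
  real quadratic polynomial annihilates the operator. If \<open>c = 0\<close>, that is \<open>\<alpha> = 2 \<beta>\<close>, then \<open>b = 0\<close> while
  \<open>a \<noteq> 0\<close>, and the only monic quadratic that does so is \<open>t (t - a)\<close>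
  (\<open>ricci_polynomial_iff\<close>).
\<close>

section \<open>Smooth functions form an algebra\<close>

text \<open>
  The derivatives in \<open>Ck_on\<close> are taken in the whole space, not within \<open>S\<close>; for open \<open>S\<close> they still
  depend only on the values in \<open>S\<close>.
\<close>

lemma Ck_on_transform:
  fixes f h :: "'b::euclidean_space \<Rightarrow> 'c::real_normed_vector"
  assumes "open S" and "\<And>x. x \<in> S \<Longrightarrow> f x = h x" and "Ck_on k S f"
  shows "Ck_on k S h"
  using assms(2,3)
proof (induction k arbitrary: f h)
  case 0
  then show ?case by (auto cong: continuous_on_cong)
next
  case (Suc k)
  have der: "(h has_derivative frechet_derivative f (at x)) (at x)" if "x \<in> S" for x
  proof (rule has_derivative_transform_within_open[OF _ assms(1) that])
    show "(f has_derivative frechet_derivative f (at x)) (at x)"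
      using Suc.prems(2) that by (simp add: frechet_derivative_works)
  qed (use Suc.prems(1) in auto)
  then have eq: "frechet_derivative f (at x) = frechet_derivative h (at x)" if "x \<in> S" for x
    using that frechet_derivative_at by blast
  have "Ck_on k S (\<lambda>x. frechet_derivative h (at x) v)" for v
    by (rule Suc.IH[where f = "\<lambda>x. frechet_derivative f (at x) v"])
       (use Suc.prems(2) eq in auto)
  moreover have "h differentiable (at x)" if "x \<in> S" for x
    using der[OF that] by (rule differentiableI)
  ultimately show ?case by simp
qed

lemma Ck_on_Suc_imp_Ck_on: "Ck_on (Suc k) S f \<Longrightarrow> Ck_on k S f"
proof (induction k arbitrary: f)
  case 0
  then show ?case
    by (simp add: continuous_at_imp_continuous_on differentiable_imp_continuous_within)
next
  case (Suc k)
  then show ?case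
    by (metis Ck_on.simps(2))
qed

lemma Ck_on_const: "Ck_on k S (\<lambda>x. c)"
  by (induction k arbitrary: c) auto

lemma Ck_on_add:
  assumes "open S" "Ck_on k S f" "Ck_on k S h"
  shows "Ck_on k S (\<lambda>x. f x + h x)"
  using assms(2,3)
proof (induction k arbitrary: f h)
  case 0
  then show ?case by (auto intro: continuous_on_add)
next
  case (Suc k)
  have der: "((\<lambda>x. f x + h x) has_derivative
      (\<lambda>v. frechet_derivative f (at x) v + frechet_derivative h (at x) v)) (at x)" if "x \<in> S" for x
    using Suc.prems that by (intro has_derivative_add) (simp_all flip: frechet_derivative_works)
  have "Ck_on k S (\<lambda>x. frechet_derivative (\<lambda>x. f x + h x) (at x) v)" for v
  proof (rule Ck_on_transform[OF assms(1)])
    show "Ck_on k S (\<lambda>x. frechet_derivative f (at x) v + frechet_derivative h (at x) v)"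
      using Suc by simp
    show "frechet_derivative f (at x) v + frechet_derivative h (at x) v
        = frechet_derivative (\<lambda>x. f x + h x) (at x) v" if "x \<in> S" for x
      using frechet_derivative_at[OF der[OF that]] by metis
  qed
  then show ?case using der by (auto simp: differentiable_def)
qed

lemma Ck_on_mult:
  fixes f h :: "'b::euclidean_space \<Rightarrow> 'c::real_normed_algebra"
  assumes "open S" "Ck_on k S f" "Ck_on k S h"
  shows "Ck_on k S (\<lambda>x. f x * h x)"
  using assms(2,3)
proof (induction k arbitrary: f h)
  case 0
  then show ?case by (auto intro: continuous_on_mult)
next
  case (Suc k)
  have der: "((\<lambda>x. f x * h x) has_derivative
      (\<lambda>v. f x * frechet_derivative h (at x) v + frechet_derivative f (at x) v * h x)) (at x)"
    if "x \<in> S" for x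
    using Suc.prems that by (intro has_derivative_mult) (simp_all flip: frechet_derivative_works)
  have "Ck_on k S (\<lambda>x. frechet_derivative (\<lambda>x. f x * h x) (at x) v)" for v
  proof (rule Ck_on_transform[OF assms(1)])
    show "Ck_on k S (\<lambda>x. f x * frechet_derivative h (at x) v + frechet_derivative f (at x) v * h x)"
      using Suc.prems Suc.prems[THEN Ck_on_Suc_imp_Ck_on]
      by (intro Ck_on_add[OF assms(1)] Suc.IH) simp_all
    show "f x * frechet_derivative h (at x) v + frechet_derivative f (at x) v * h x
        = frechet_derivative (\<lambda>x. f x * h x) (at x) v" if "x \<in> S" for x
      using frechet_derivative_at[OF der[OF that]] by metis
  qed
  then show ?case using der by (auto simp: differentiable_def)
qed

lemma smooth_functions_const: "(\<lambda>p. c) \<in> smooth_functions A"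
  by (auto simp: smooth_functions_def smooth_on_def Ck_on_const)

lemma smooth_functions_add:
  assumes "smooth_atlas A" "f \<in> smooth_functions A" "h \<in> smooth_functions A"
  shows "(\<lambda>p. f p + h p) \<in> smooth_functions A"
  using assms by (fastforce simp: smooth_functions_def smooth_on_def smooth_atlas_def intro: Ck_on_add)

lemma smooth_functions_mult:
  assumes "smooth_atlas A" "f \<in> smooth_functions A" "h \<in> smooth_functions A"
  shows "(\<lambda>p. f p * h p) \<in> smooth_functions A"
  using assms by (fastforce simp: smooth_functions_def smooth_on_def smooth_atlas_def intro: Ck_on_mult)

section \<open>Vector fields form a module over the smooth functions\<close>

lemma tangent_space_add:
  "u \<in> tangent_space A p \<Longrightarrow> v \<in> tangent_space A p \<Longrightarrow> u + v \<in> tangent_space A p"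
  by (auto simp: tangent_space_def algebra_simps)

lemma tangent_space_scaleR: "u \<in> tangent_space A p \<Longrightarrow> c *\<^sub>R u \<in> tangent_space A p"
  by (auto simp: tangent_space_def scaleR_fun_def algebra_simps)

text \<open>A derivation kills constants: the Leibniz rule for \<open>1 * 1 = 1\<close> gives \<open>D 1 = 2 * D 1\<close>.\<close>

lemma tangent_space_const:
  assumes "D \<in> tangent_space A p"
  shows "D (\<lambda>q. c) = 0"
proof -
  let ?one = "\<lambda>q::'a. 1::real"
  have "D (?one * ?one) = 1 * D ?one + 1 * D ?one"
    using assms smooth_functions_const[of 1 A] unfolding tangent_space_def by blast
  moreover have "?one * ?one = ?one" by (simp add: fun_eq_iff)
  ultimately have "D ?one = 0" by simp
  moreover have "D (c *\<^sub>R ?one) = c * D ?one"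
    using assms smooth_functions_const[of 1 A] unfolding tangent_space_def by blast
  moreover have "c *\<^sub>R ?one = (\<lambda>q. c)" by (simp add: fun_eq_iff scaleR_fun_def)
  ultimately show ?thesis by simp
qed

lemma vector_fields_tangent: "X \<in> vector_fields A \<Longrightarrow> X p \<in> tangent_space A p"
  by (simp add: vector_fields_def)

lemma vector_fields_apply: "X \<in> vector_fields A \<Longrightarrow> f \<in> smooth_functions A \<Longrightarrow>
    (\<lambda>p. X p f) \<in> smooth_functions A"
  by (simp add: vector_fields_def)

lemma vector_fields_add:
  "smooth_atlas A \<Longrightarrow> X \<in> vector_fields A \<Longrightarrow> Y \<in> vector_fields A \<Longrightarrow> X + Y \<in> vector_fields A"
  by (auto simp: vector_fields_def intro: tangent_space_add smooth_functions_add)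

lemma vector_fields_fscale:
  "smooth_atlas A \<Longrightarrow> f \<in> smooth_functions A \<Longrightarrow> X \<in> vector_fields A \<Longrightarrow> fscale f X \<in> vector_fields A"
  by (auto simp: vector_fields_def fscale_def tangent_space_scaleR)
     (auto simp: scaleR_fun_def smooth_functions_mult)

lemma scaleR_eq_fscale: "c *\<^sub>R X = fscale (\<lambda>p. c) X"
  by (simp add: fscale_def scaleR_fun_def)

lemma fscale_add_right: "fscale f (X + Y) = fscale f X + fscale f Y"
  by (simp add: fscale_def fun_eq_iff scaleR_fun_def algebra_simps)

lemma fscale_diff_right: "fscale f (X - Y) = fscale f X - fscale f Y"
  by (simp add: fscale_def fun_eq_iff scaleR_fun_def algebra_simps)

lemma fscale_diff_left: "fscale (\<lambda>p. f p - h p) X = fscale f X - fscale h X"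
  by (simp add: fscale_def fun_eq_iff scaleR_fun_def algebra_simps)

lemma vector_fields_scaleR:
  "smooth_atlas A \<Longrightarrow> X \<in> vector_fields A \<Longrightarrow> c *\<^sub>R X \<in> vector_fields A"
  unfolding scaleR_eq_fscale by (intro vector_fields_fscale smooth_functions_const)

lemma vector_fields_diff:
  assumes "smooth_atlas A" "X \<in> vector_fields A" "Y \<in> vector_fields A"
  shows "X - Y \<in> vector_fields A"
  using vector_fields_add[OF assms(1,2) vector_fields_scaleR[OF assms(1,3), of "-1"]] by simp

section \<open>Levi-Civita connection and curvature in a pseudo-orthonormal frame\<close>

text \<open>
  The frame is an arbitrary global pseudo-orthonormal frame of smooth vector fields; neither a group
  structure nor any condition on the brackets is involved.
\<close>

locale lorentz_frame =
  fixes A :: "'a::topological_space chart set"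
    and g :: "'a tensor2"
    and nab :: "'a vector_field \<Rightarrow> 'a vector_field \<Rightarrow> 'a vector_field"
    and e1 e2 e3 :: "'a vector_field"
  assumes atlas: "smooth_atlas A"
    and metric: "lorentzian_metric A g"
    and levi_civita: "levi_civita_connection A g nab"
    and frame: "e1 \<in> vector_fields A" "e2 \<in> vector_fields A" "e3 \<in> vector_fields A"
    and orthonormal: "\<And>p. pseudo_orthonormal (g p) (e1 p) (e2 p) (e3 p)"
begin

lemmas vf_intros [simp] =
  frame vector_fields_add[OF atlas] vector_fields_fscale[OF atlas] vector_fields_scaleR[OF atlas]
  vector_fields_diff[OF atlas] vector_fields_tangent vector_fields_apply

lemmas smooth_intros [simp] =
  smooth_functions_const smooth_functions_add[OF atlas] smooth_functions_mult[OF atlas]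

lemma metric_sym:
  "u \<in> tangent_space A p \<Longrightarrow> v \<in> tangent_space A p \<Longrightarrow> g p u v = g p v u"
  using metric unfolding lorentzian_metric_def by blast

lemma metric_add_left:
  "u \<in> tangent_space A p \<Longrightarrow> v \<in> tangent_space A p \<Longrightarrow> w \<in> tangent_space A p \<Longrightarrow>
    g p (u + v) w = g p u w + g p v w"
  using metric unfolding lorentzian_metric_def by blast

lemma metric_scaleR_left:
  "u \<in> tangent_space A p \<Longrightarrow> w \<in> tangent_space A p \<Longrightarrow> g p (c *\<^sub>R u) w = c * g p u w"
  using metric unfolding lorentzian_metric_def by blast

lemma metric_diff_left:
  assumes "u \<in> tangent_space A p" "v \<in> tangent_space A p" "w \<in> tangent_space A p"
  shows "g p (u - v) w = g p u w - g p v w"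
  using metric_add_left[OF assms(1) tangent_space_scaleR[OF assms(2), of "-1"] assms(3)]
    metric_scaleR_left[OF assms(2,3), of "-1"] by simp

lemma metric_smooth [simp]:
  "X \<in> vector_fields A \<Longrightarrow> Y \<in> vector_fields A \<Longrightarrow> (\<lambda>p. g p (X p) (Y p)) \<in> smooth_functions A"
  using metric unfolding lorentzian_metric_def by blast

lemma frame_metric [simp]:
  "g p (e1 p) (e1 p) = 1" "g p (e2 p) (e2 p) = 1" "g p (e3 p) (e3 p) = - 1"
  "g p (e1 p) (e2 p) = 0" "g p (e2 p) (e1 p) = 0" "g p (e1 p) (e3 p) = 0"
  "g p (e3 p) (e1 p) = 0" "g p (e2 p) (e3 p) = 0" "g p (e3 p) (e2 p) = 0"
  using orthonormal[of p] by (auto simp: pseudo_orthonormal_def)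

lemma metric_frame_sum:
  "g p (x *\<^sub>R e1 p + y *\<^sub>R e2 p + z *\<^sub>R e3 p) (e1 p) = x"
  "g p (x *\<^sub>R e1 p + y *\<^sub>R e2 p + z *\<^sub>R e3 p) (e2 p) = y"
  "g p (x *\<^sub>R e1 p + y *\<^sub>R e2 p + z *\<^sub>R e3 p) (e3 p) = - z"
  by (simp_all add: metric_add_left metric_scaleR_left tangent_space_add tangent_space_scaleR)

text \<open>
  Pseudo-orthonormality makes the three frame vectors independent, and the tangent space, being
  spanned by three vectors, has dimension at most three.
\<close>

lemma frame_spans: "span {e1 p, e2 p, e3 p} = tangent_space A p"
proof -
  obtain v1 v2 v3 where v: "span {v1, v2, v3} = tangent_space A p"
    using metric unfolding lorentzian_metric_def by metis
  have dist: "e1 p \<noteq> e2 p" "e1 p \<noteq> e3 p" "e2 p \<noteq> e3 p"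
    using frame_metric[of p] by (metis zero_neq_one neg_equal_0_iff_equal)+
  have indep: "independent {e1 p, e2 p, e3 p}"
  proof
    assume "dependent {e1 p, e2 p, e3 p}"
    then obtain f where sum: "(\<Sum>v\<in>{e1 p, e2 p, e3 p}. f v *\<^sub>R v) = 0"
      and nonzero: "\<exists>v\<in>{e1 p, e2 p, e3 p}. f v \<noteq> 0"
      by (subst (asm) dependent_finite) auto
    from sum have z: "f (e1 p) *\<^sub>R e1 p + f (e2 p) *\<^sub>R e2 p + f (e3 p) *\<^sub>R e3 p = 0"
      using dist by (simp add: add.assoc)
    have "g p 0 w = 0" if "w \<in> tangent_space A p" for w
      using metric_scaleR_left[OF that that, of 0] by simp
    then have zero: "g p 0 (e1 p) = 0" "g p 0 (e2 p) = 0" "g p 0 (e3 p) = 0"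
      by (simp_all only: vector_fields_tangent frame)
    note comb = metric_frame_sum[of p "f (e1 p)" "f (e2 p)" "f (e3 p)", unfolded z zero]
    have "f (e1 p) = 0" "f (e2 p) = 0" "f (e3 p) = 0"
      using comb by linarith+
    with nonzero show False by simp
  qed
  \<comment> \<open>A tangent vector outside the span would give four independent vectors.\<close>
  have "v \<in> span {e1 p, e2 p, e3 p}" if "v \<in> tangent_space A p" for v
  proof (rule ccontr)
    assume out: "v \<notin> span {e1 p, e2 p, e3 p}"
    then have "independent (insert v {e1 p, e2 p, e3 p})"
      using indep by (rule independent_insertI)
    moreover have "insert v {e1 p, e2 p, e3 p} \<subseteq> span {v1, v2, v3}"
      using that unfolding v by simp
    ultimately have "card (insert v {e1 p, e2 p, e3 p}) \<le> card {v1, v2, v3}"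
      using independent_span_bound[of "{v1, v2, v3}"] by blast
    also have "\<dots> \<le> 3" by (simp add: card_insert_if)
    finally have "card (insert v {e1 p, e2 p, e3 p}) \<le> 3" .
    moreover have "v \<notin> {e1 p, e2 p, e3 p}"
      using out span_base by metis
    ultimately show False
      using dist by simp
  qed
  moreover have "span {e1 p, e2 p, e3 p} \<subseteq> tangent_space A p"
  proof (rule span_minimal)
    show "subspace (tangent_space A p)" using v subspace_span by metis
  qed simp
  ultimately show ?thesis by blast
qed

text \<open>The minus sign in the last coefficient comes from \<open>g(e3, e3) = - 1\<close>.\<close>

lemma tangent_expand:
  assumes "v \<in> tangent_space A p"
  shows "v = g p v (e1 p) *\<^sub>R e1 p + g p v (e2 p) *\<^sub>R e2 p + (- g p v (e3 p)) *\<^sub>R e3 p"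
proof -
  have "v \<in> span {e1 p, e2 p, e3 p}" using assms frame_spans by simp
  then obtain x y z where "v - x *\<^sub>R e1 p - y *\<^sub>R e2 p - z *\<^sub>R e3 p = 0"
    by (auto simp: span_breakdown_eq)
  then have v: "v = x *\<^sub>R e1 p + y *\<^sub>R e2 p + z *\<^sub>R e3 p"
    by (simp add: algebra_simps)
  then have "g p v (e1 p) = x" "g p v (e2 p) = y" "- g p v (e3 p) = z"
    using metric_frame_sum[of p x y z] by simp_all
  then show ?thesis using v by (simp only:)
qed

text \<open>Nondegeneracy of the metric, tested on the frame.\<close>

lemma tangent_eqI:
  assumes "u \<in> tangent_space A p" "v \<in> tangent_space A p"
    and "g p u (e1 p) = g p v (e1 p)" "g p u (e2 p) = g p v (e2 p)" "g p u (e3 p) = g p v (e3 p)"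
  shows "u = v"
  using tangent_expand[OF assms(1)] tangent_expand[OF assms(2)] assms(3-5) by simp

lemma vector_field_expand:
  assumes "X \<in> vector_fields A"
  obtains x y z where "x \<in> smooth_functions A" "y \<in> smooth_functions A" "z \<in> smooth_functions A"
    "X = fscale x e1 + fscale y e2 + fscale z e3"
proof
  let ?x = "\<lambda>p. g p (X p) (e1 p)" and ?y = "\<lambda>p. g p (X p) (e2 p)"
    and ?z = "\<lambda>p. (- 1) * g p (X p) (e3 p)"
  show "?x \<in> smooth_functions A" "?y \<in> smooth_functions A" "?z \<in> smooth_functions A"
    using assms by (intro smooth_intros metric_smooth frame; simp)+
  show "X = fscale ?x e1 + fscale ?y e2 + fscale ?z e3"
  proof
    fix p
    show "X p = (fscale ?x e1 + fscale ?y e2 + fscale ?z e3) p"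
      using tangent_expand[of "X p" p] assms by (simp add: fscale_def)
  qed
qed

lemma nab_field [simp]: "X \<in> vector_fields A \<Longrightarrow> Y \<in> vector_fields A \<Longrightarrow> nab X Y \<in> vector_fields A"
  using levi_civita unfolding levi_civita_connection_def affine_connection_def by blast

lemma nab_add [simp]:
  assumes "X \<in> vector_fields A" "Y \<in> vector_fields A" "Z \<in> vector_fields A"
  shows "nab (X + Y) Z = nab X Z + nab Y Z" "nab X (Y + Z) = nab X Y + nab X Z"
  using assms levi_civita unfolding levi_civita_connection_def affine_connection_def by blast+

lemma nab_fscale [simp]:
  assumes "X \<in> vector_fields A" "Y \<in> vector_fields A" "f \<in> smooth_functions A"
  shows "nab (fscale f X) Y = fscale f (nab X Y)"
    "nab X (fscale f Y) = fscale (\<lambda>p. X p f) Y + fscale f (nab X Y)"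
  using assms levi_civita unfolding levi_civita_connection_def affine_connection_def by blast+

lemma nab_scaleR [simp]:
  assumes "X \<in> vector_fields A" "Y \<in> vector_fields A"
  shows "nab (c *\<^sub>R X) Y = c *\<^sub>R nab X Y" "nab X (c *\<^sub>R Y) = c *\<^sub>R nab X Y"
proof -
  show "nab (c *\<^sub>R X) Y = c *\<^sub>R nab X Y" using assms by (simp add: scaleR_eq_fscale)
  have "(\<lambda>p. X p (\<lambda>q. c)) = (\<lambda>p. 0)"
    using assms(1) by (simp add: tangent_space_const[OF vector_fields_tangent])
  then show "nab X (c *\<^sub>R Y) = c *\<^sub>R nab X Y"
    using assms by (simp add: scaleR_eq_fscale) (simp add: fscale_def fun_eq_iff scaleR_fun_def)
qed

lemma nab_diff [simp]:
  assumes "X \<in> vector_fields A" "Y \<in> vector_fields A" "Z \<in> vector_fields A"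
  shows "nab (X - Y) Z = nab X Z - nab Y Z" "nab X (Y - Z) = nab X Y - nab X Z"
proof -
  have "nab (X + (- 1) *\<^sub>R Y) Z = nab X Z + (- 1) *\<^sub>R nab Y Z"
    "nab X (Y + (- 1) *\<^sub>R Z) = nab X Y + (- 1) *\<^sub>R nab X Z"
    using assms by (simp_all only: nab_add nab_scaleR vf_intros)
  then show "nab (X - Y) Z = nab X Z - nab Y Z" "nab X (Y - Z) = nab X Y - nab X Z"
    by simp_all
qed

lemma torsion_free:
  "X \<in> vector_fields A \<Longrightarrow> Y \<in> vector_fields A \<Longrightarrow> lie_bracket X Y = nab X Y - nab Y X"
  using levi_civita unfolding levi_civita_connection_def by metis

lemma metric_compatible:
  assumes "X \<in> vector_fields A" "Y \<in> vector_fields A" "Z \<in> vector_fields A"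
  shows "X p (\<lambda>q. g q (Y q) (Z q)) = g p (nab X Y p) (Z p) + g p (Y p) (nab X Z p)"
  using assms levi_civita unfolding levi_civita_connection_def by blast

lemma lie_bracket_field [simp]:
  "X \<in> vector_fields A \<Longrightarrow> Y \<in> vector_fields A \<Longrightarrow> lie_bracket X Y \<in> vector_fields A"
  by (simp add: torsion_free)

text \<open>
  The Koszul formula for fields with constant mutual inner products, where the three derivative
  terms vanish.
\<close>

lemma koszul:
  assumes fields: "X \<in> vector_fields A" "Y \<in> vector_fields A" "Z \<in> vector_fields A"
    and const: "\<And>p. g p (X p) (Y p) = a" "\<And>p. g p (Y p) (Z p) = b" "\<And>p. g p (Z p) (X p) = c"
  shows "2 * g p (nab X Y p) (Z p) = g p (lie_bracket X Y p) (Z p)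
    - g p (lie_bracket Y Z p) (X p) + g p (lie_bracket Z X p) (Y p)"
proof -
  have zero: "U p (\<lambda>q. d) = 0" if "U \<in> vector_fields A" for U d
    using that by (rule tangent_space_const[OF vector_fields_tangent])
  have "g p (nab X Y p) (Z p) + g p (Y p) (nab X Z p) = 0"
    "g p (nab Y Z p) (X p) + g p (Z p) (nab Y X p) = 0"
    "g p (nab Z X p) (Y p) + g p (X p) (nab Z Y p) = 0"
    using metric_compatible[OF fields(1,2,3), of p] metric_compatible[OF fields(2,3,1), of p]
      metric_compatible[OF fields(3,1,2), of p] fields
    by (simp_all add: const zero)
  moreover have "g p (U p) (V p) = g p (V p) (U p)"
    if "U \<in> vector_fields A" "V \<in> vector_fields A" for U V
    using that by (simp add: metric_sym)
  ultimately show ?thesis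
    using fields by (simp add: torsion_free metric_diff_left)
qed

text \<open>
  The curvature is linear over the smooth functions in its first and third argument; this
  suffices for the Ricci tensor, in which the second argument of the curvature is a frame field.
\<close>

lemma curvature_add:
  assumes "X \<in> vector_fields A" "Y \<in> vector_fields A" "Z \<in> vector_fields A" "W \<in> vector_fields A"
  shows "curvature nab (X + W) Y Z = curvature nab X Y Z + curvature nab W Y Z"
    "curvature nab X Y (Z + W) = curvature nab X Y Z + curvature nab X Y W"
  using assms by (simp_all add: curvature_def torsion_free algebra_simps)

lemma curvature_fscale:
  assumes "X \<in> vector_fields A" "Y \<in> vector_fields A" "Z \<in> vector_fields A" "f \<in> smooth_functions A"
  shows "curvature nab (fscale f X) Y Z = fscale f (curvature nab X Y Z)"
    "curvature nab X Y (fscale f Z) = fscale f (curvature nab X Y Z)"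
proof -
  show "curvature nab (fscale f X) Y Z = fscale f (curvature nab X Y Z)"
    using assms
    by (simp add: curvature_def torsion_free fscale_add_right fscale_diff_right algebra_simps)
  have "fscale (\<lambda>p. lie_bracket X Y p f) Z
      = fscale (\<lambda>p. X p (\<lambda>q. Y q f)) Z - fscale (\<lambda>p. Y p (\<lambda>q. X q f)) Z"
    by (simp add: lie_bracket_def fscale_diff_left)
  then show "curvature nab X Y (fscale f Z) = fscale f (curvature nab X Y Z)"
    using assms
    by (simp add: curvature_def fscale_add_right fscale_diff_right algebra_simps)
qed

lemma curvature_field [simp]:
  "X \<in> vector_fields A \<Longrightarrow> Y \<in> vector_fields A \<Longrightarrow> Z \<in> vector_fields A \<Longrightarrow>
    curvature nab X Y Z \<in> vector_fields A"
  by (simp add: curvature_def)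

text \<open>The Ricci tensor computed in the given frame.\<close>

abbreviation Ric where "Ric \<equiv> ricci g nab e1 e2 e3"

lemma ricci_add:
  assumes "X \<in> vector_fields A" "Y \<in> vector_fields A" "Z \<in> vector_fields A"
  shows "Ric (X + Z) Y p = Ric X Y p + Ric Z Y p" "Ric X (Y + Z) p = Ric X Y p + Ric X Z p"
  using assms by (simp_all add: ricci_def curvature_add metric_add_left)

lemma ricci_fscale:
  assumes "X \<in> vector_fields A" "Y \<in> vector_fields A" "f \<in> smooth_functions A"
  shows "Ric (fscale f X) Y p = f p * Ric X Y p" "Ric X (fscale f Y) p = f p * Ric X Y p"
proof -
  have "g p (fscale f U p) (V p) = f p * g p (U p) (V p)"
    if "U \<in> vector_fields A" "V \<in> vector_fields A" for U V
    using that by (simp add: fscale_def metric_scaleR_left)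
  then show "Ric (fscale f X) Y p = f p * Ric X Y p" "Ric X (fscale f Y) p = f p * Ric X Y p"
    using assms by (simp_all add: ricci_def curvature_fscale algebra_simps)
qed

text \<open>
  The combination of the frame fields with constant coefficients. For a left-invariant frame these
  are the left-invariant vector fields.
\<close>

definition frame_comb :: "real \<Rightarrow> real \<Rightarrow> real \<Rightarrow> 'a vector_field" where
  "frame_comb x y z = x *\<^sub>R e1 + y *\<^sub>R e2 + z *\<^sub>R e3"

lemma frame_comb_field [simp]: "frame_comb x y z \<in> vector_fields A"
  by (simp add: frame_comb_def)

lemma frame_comb_cong:
  "x = x' \<Longrightarrow> y = y' \<Longrightarrow> z = z' \<Longrightarrow> frame_comb x y z = frame_comb x' y' z'"
  by simp

lemma frame_comb_eqI:
  assumes "X \<in> vector_fields A"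
    and "\<And>p. g p (X p) (e1 p) = x" "\<And>p. g p (X p) (e2 p) = y" "\<And>p. g p (X p) (e3 p) = - z"
  shows "X = frame_comb x y z"
proof
  fix p
  show "X p = frame_comb x y z p"
    using tangent_expand[of "X p" p] assms by (simp add: frame_comb_def scaleR_fun_def)
qed

lemma metric_frame_comb:
  "g p (frame_comb x y z p) (e1 p) = x"
  "g p (frame_comb x y z p) (e2 p) = y"
  "g p (frame_comb x y z p) (e3 p) = - z"
  using metric_frame_sum[of p x y z] by (simp_all add: frame_comb_def scaleR_fun_def)

lemma frame_comb_linear:
  "frame_comb x y z + frame_comb x' y' z' = frame_comb (x + x') (y + y') (z + z')"
  "frame_comb x y z - frame_comb x' y' z' = frame_comb (x - x') (y - y') (z - z')"
  "c *\<^sub>R frame_comb x y z = frame_comb (c * x) (c * y) (c * z)"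
  by (simp_all add: frame_comb_def algebra_simps)

lemma frame_eq_comb: "e1 = frame_comb 1 0 0" "e2 = frame_comb 0 1 0" "e3 = frame_comb 0 0 1"
  by (simp_all add: frame_comb_def)

section \<open>The \<open>Ein(2)\<close> condition in terms of the Ricci components\<close>

lemma metric_components:
  "g p ((fscale x e1 + fscale y e2 + fscale z e3) p) ((fscale x' e1 + fscale y' e2 + fscale z' e3) p)
    = x p * x' p + y p * y' p - z p * z' p"
proof -
  have right: "g p u (v + w) = g p u v + g p u w" "g p u (k *\<^sub>R w) = k * g p u w"
    if "u \<in> tangent_space A p" "v \<in> tangent_space A p" "w \<in> tangent_space A p" for u v w k
    using that
    by (simp_all add: metric_sym[of u] metric_add_left metric_scaleR_left tangent_space_add
        tangent_space_scaleR)
  show ?thesis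
    by (simp add: fscale_def right[where v = "e1 p"] right metric_add_left metric_scaleR_left
        tangent_space_add tangent_space_scaleR)
qed

text \<open>
  From here on the Ricci tensor is assumed to have constant components of the shape that occurs for
  \<open>G\<^sub>2\<close>: the field \<open>e1\<close> is a Ricci eigenvector, and on the plane of \<open>e2\<close> and \<open>e3\<close>, read as the
  complex numbers \<open>1\<close> and \<open>- i\<close>, the Ricci operator is multiplication by \<open>b + i c\<close>.
\<close>

context
  fixes a b c :: real
  assumes ricci_frame:
    "\<And>p. Ric e1 e1 p = a" "\<And>p. Ric e1 e2 p = 0" "\<And>p. Ric e1 e3 p = 0"
    "\<And>p. Ric e2 e1 p = 0" "\<And>p. Ric e2 e2 p = b" "\<And>p. Ric e2 e3 p = c"
    "\<And>p. Ric e3 e1 p = 0" "\<And>p. Ric e3 e2 p = c" "\<And>p. Ric e3 e3 p = - b"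
begin

lemma ricci_components:
  assumes "x \<in> smooth_functions A" "y \<in> smooth_functions A" "z \<in> smooth_functions A"
    and "x' \<in> smooth_functions A" "y' \<in> smooth_functions A" "z' \<in> smooth_functions A"
  shows "Ric (fscale x e1 + fscale y e2 + fscale z e3) (fscale x' e1 + fscale y' e2 + fscale z' e3) p
    = a * x p * x' p + b * (y p * y' p - z p * z' p) + c * (y p * z' p + z p * y' p)"
  using assms by (simp add: ricci_add ricci_fscale ricci_frame algebra_simps)

text \<open>
  The definite description is resolved by exhibiting a field with the required property; it is the
  only one by nondegeneracy of the metric.
\<close>

lemma ricci_operator_components:
  assumes "x \<in> smooth_functions A" "y \<in> smooth_functions A" "z \<in> smooth_functions A"
  shows "ricci_operator A g nab e1 e2 e3 (fscale x e1 + fscale y e2 + fscale z e3)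
    = fscale (\<lambda>p. a * x p) e1 + fscale (\<lambda>p. b * y p + c * z p) e2
      + fscale (\<lambda>p. b * z p + (- c) * y p) e3"
    (is "_ = ?Z")
  unfolding ricci_operator_def
proof (rule the_equality)
  let ?X = "fscale x e1 + fscale y e2 + fscale z e3"
  have Z: "?Z \<in> vector_fields A"
    by (intro vector_fields_add[OF atlas] vector_fields_fscale[OF atlas] frame smooth_intros assms)
  moreover have dual: "Ric ?X Y p = g p (?Z p) (Y p)" if field: "Y \<in> vector_fields A" for Y p
  proof -
    obtain x' y' z' where Y: "x' \<in> smooth_functions A" "y' \<in> smooth_functions A"
      "z' \<in> smooth_functions A" "Y = fscale x' e1 + fscale y' e2 + fscale z' e3"
      using vector_field_expand[OF field] .
    show ?thesis
      unfolding Y(4) metric_components ricci_components[OF assms Y(1-3)]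
      by (simp add: algebra_simps)
  qed
  ultimately show "?Z \<in> vector_fields A \<and> (\<forall>Y\<in>vector_fields A. \<forall>p. Ric ?X Y p = g p (?Z p) (Y p))"
    by blast
  fix W
  assume W: "W \<in> vector_fields A \<and> (\<forall>Y\<in>vector_fields A. \<forall>p. Ric ?X Y p = g p (W p) (Y p))"
  show "W = ?Z"
  proof
    fix p
    have eq: "g p (W p) (Y p) = g p (?Z p) (Y p)" if "Y \<in> vector_fields A" for Y
      using W dual[OF that] that by metis
    show "W p = ?Z p"
      by (rule tangent_eqI[OF vector_fields_tangent[OF conjunct1[OF W]] vector_fields_tangent[OF Z]
            eq[OF frame(1)] eq[OF frame(2)] eq[OF frame(3)]])
  qed
qed

lemma ricci2_components:
  assumes "x \<in> smooth_functions A" "y \<in> smooth_functions A" "z \<in> smooth_functions A"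
    and "x' \<in> smooth_functions A" "y' \<in> smooth_functions A" "z' \<in> smooth_functions A"
  shows "ricci2 A g nab e1 e2 e3 (fscale x e1 + fscale y e2 + fscale z e3)
      (fscale x' e1 + fscale y' e2 + fscale z' e3) p
    = a\<^sup>2 * x p * x' p + (b\<^sup>2 - c\<^sup>2) * (y p * y' p - z p * z' p)
      + 2 * b * c * (y p * z' p + z p * y' p)"
proof -
  have "(\<lambda>p. a * x p) \<in> smooth_functions A" "(\<lambda>p. b * y p + c * z p) \<in> smooth_functions A"
    "(\<lambda>p. b * z p + (- c) * y p) \<in> smooth_functions A"
    by (intro smooth_intros assms)+
  then show ?thesis
    unfolding ricci2_def ricci_operator_components[OF assms(1-3)]
    by (subst ricci_components) (use assms in \<open>simp_all add: algebra_simps power2_eq_square\<close>)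
qed

lemma Ein2_iff:
  "Ein2 A g nab e1 e2 e3 l1 l2 \<longleftrightarrow>
    a\<^sup>2 + l1 * a + l2 = 0 \<and> b\<^sup>2 - c\<^sup>2 + l1 * b + l2 = 0 \<and> c * (2 * b + l1) = 0"
proof
  assume ein: "Ein2 A g nab e1 e2 e3 l1 l2"
  \<comment> \<open>Constant coefficients suffice in this direction; the frame fields themselves are then inserted.\<close>
  let ?E = "\<lambda>x y z :: real. fscale (\<lambda>p. x) e1 + fscale (\<lambda>p. y) e2 + fscale (\<lambda>p. z) e3"
  have eq: "a\<^sup>2 * x * x' + (b\<^sup>2 - c\<^sup>2) * (y * y' - z * z') + 2 * b * c * (y * z' + z * y')
      + l1 * (a * x * x' + b * (y * y' - z * z') + c * (y * z' + z * y'))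
      + l2 * (x * x' + y * y' - z * z') = 0" for x y z x' y' z'
  proof -
    have "ricci2 A g nab e1 e2 e3 (?E x y z) (?E x' y' z') p + l1 * Ric (?E x y z) (?E x' y' z') p
      + l2 * g p (?E x y z p) (?E x' y' z' p) = 0" for p
      using ein unfolding Ein2_def by (simp del: plus_fun_apply)
    then show ?thesis
      by (simp only: ricci2_components ricci_components metric_components smooth_functions_const)
  qed
  show "a\<^sup>2 + l1 * a + l2 = 0 \<and> b\<^sup>2 - c\<^sup>2 + l1 * b + l2 = 0 \<and> c * (2 * b + l1) = 0"
    using eq[of 1 1 0 0 0 0] eq[of 0 0 1 1 0 0] eq[of 0 0 1 0 0 1] by (simp add: algebra_simps)
next
  assume eqs: "a\<^sup>2 + l1 * a + l2 = 0 \<and> b\<^sup>2 - c\<^sup>2 + l1 * b + l2 = 0 \<and> c * (2 * b + l1) = 0"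
  show "Ein2 A g nab e1 e2 e3 l1 l2"
    unfolding Ein2_def
  proof (intro ballI allI)
    fix X Y p
    assume "X \<in> vector_fields A" "Y \<in> vector_fields A"
    obtain x y z where X: "x \<in> smooth_functions A" "y \<in> smooth_functions A"
      "z \<in> smooth_functions A" "X = fscale x e1 + fscale y e2 + fscale z e3"
      using vector_field_expand[OF \<open>X \<in> vector_fields A\<close>] .
    obtain x' y' z' where Y: "x' \<in> smooth_functions A" "y' \<in> smooth_functions A"
      "z' \<in> smooth_functions A" "Y = fscale x' e1 + fscale y' e2 + fscale z' e3"
      using vector_field_expand[OF \<open>Y \<in> vector_fields A\<close>] .
    have "ricci2 A g nab e1 e2 e3 X Y p + l1 * Ric X Y p + l2 * g p (X p) (Y p)
      = (a\<^sup>2 + l1 * a + l2) * (x p * x' p)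
        + (b\<^sup>2 - c\<^sup>2 + l1 * b + l2) * (y p * y' p - z p * z' p)
        + c * (2 * b + l1) * (y p * z' p + z p * y' p)"
      unfolding X(4) Y(4) ricci2_components[OF X(1-3) Y(1-3)] ricci_components[OF X(1-3) Y(1-3)]
        metric_components
      by (simp add: algebra_simps)
    also have "\<dots> = 0" using eqs by simp
    finally show "ricci2 A g nab e1 e2 e3 X Y p + l1 * Ric X Y p + l2 * g p (X p) (Y p) = 0" .
  qed
qed

end

end

section \<open>The Ricci tensor of \<open>G\<^sub>2\<close>\<close>

text \<open>
  A pseudo-orthonormal frame with the bracket relations of \<open>G\<^sub>2\<close>. By the Koszul formula the
  combinations with constant coefficients are then closed under the Levi-Civita connection.
\<close>

locale G2_frame = lorentz_frame A g nab e1 e2 e3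
  for A :: "'a::topological_space chart set" and g :: "'a tensor2"
    and nab :: "'a vector_field \<Rightarrow> 'a vector_field \<Rightarrow> 'a vector_field"
    and e1 e2 e3 :: "'a vector_field" +
  fixes \<alpha> \<beta> \<gamma> :: real
  assumes brackets: "lie_bracket e1 e2 = \<gamma> *\<^sub>R e2 - \<beta> *\<^sub>R e3"
    "lie_bracket e1 e3 = - \<beta> *\<^sub>R e2 - \<gamma> *\<^sub>R e3" "lie_bracket e2 e3 = \<alpha> *\<^sub>R e1"
begin

lemma bracket_table:
  "lie_bracket e1 e1 = frame_comb 0 0 0" "lie_bracket e1 e2 = frame_comb 0 \<gamma> (- \<beta>)"
  "lie_bracket e1 e3 = frame_comb 0 (- \<beta>) (- \<gamma>)" "lie_bracket e2 e1 = frame_comb 0 (- \<gamma>) \<beta>"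
  "lie_bracket e2 e2 = frame_comb 0 0 0" "lie_bracket e2 e3 = frame_comb \<alpha> 0 0"
  "lie_bracket e3 e1 = frame_comb 0 \<beta> \<gamma>" "lie_bracket e3 e2 = frame_comb (- \<alpha>) 0 0"
  "lie_bracket e3 e3 = frame_comb 0 0 0"
proof -
  have anti: "lie_bracket X Y = - lie_bracket Y X" for X Y :: "'a vector_field"
    by (simp add: lie_bracket_def fun_eq_iff)
  show "lie_bracket e1 e1 = frame_comb 0 0 0" "lie_bracket e2 e2 = frame_comb 0 0 0"
    "lie_bracket e3 e3 = frame_comb 0 0 0"
    by (simp_all add: lie_bracket_def frame_comb_def fun_eq_iff)
  show "lie_bracket e1 e2 = frame_comb 0 \<gamma> (- \<beta>)" "lie_bracket e1 e3 = frame_comb 0 (- \<beta>) (- \<gamma>)"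
    "lie_bracket e2 e3 = frame_comb \<alpha> 0 0"
    by (simp_all add: brackets frame_comb_def)
  show "lie_bracket e2 e1 = frame_comb 0 (- \<gamma>) \<beta>" "lie_bracket e3 e1 = frame_comb 0 \<beta> \<gamma>"
    "lie_bracket e3 e2 = frame_comb (- \<alpha>) 0 0"
    using anti[of e2 e1] anti[of e3 e1] anti[of e3 e2] by (simp_all add: brackets frame_comb_def)
qed

lemma nab_table:
  "nab e1 e1 = frame_comb 0 0 0" "nab e1 e2 = frame_comb 0 0 ((\<alpha> - 2 * \<beta>) / 2)"
  "nab e1 e3 = frame_comb 0 ((\<alpha> - 2 * \<beta>) / 2) 0"
  "nab e2 e1 = frame_comb 0 (- \<gamma>) (\<alpha> / 2)" "nab e2 e2 = frame_comb \<gamma> 0 0"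
  "nab e2 e3 = frame_comb (\<alpha> / 2) 0 0"
  "nab e3 e1 = frame_comb 0 (\<alpha> / 2) \<gamma>" "nab e3 e2 = frame_comb (- \<alpha> / 2) 0 0"
  "nab e3 e3 = frame_comb \<gamma> 0 0"
proof -
  have koszul': "g p (nab X Y p) (Z p) = (g p (lie_bracket X Y p) (Z p)
      - g p (lie_bracket Y Z p) (X p) + g p (lie_bracket Z X p) (Y p)) / 2"
    if "X \<in> {e1, e2, e3}" "Y \<in> {e1, e2, e3}" "Z \<in> {e1, e2, e3}" for X Y Z p
  proof -
    have const: "\<exists>k. \<forall>p. g p (U p) (V p) = k" if "U \<in> {e1, e2, e3}" "V \<in> {e1, e2, e3}" for U V
      using that by auto
    from const[OF that(1,2)] obtain k1 where k1: "\<forall>p. g p (X p) (Y p) = k1" ..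
    from const[OF that(2,3)] obtain k2 where k2: "\<forall>p. g p (Y p) (Z p) = k2" ..
    from const[OF that(3,1)] obtain k3 where k3: "\<forall>p. g p (Z p) (X p) = k3" ..
    note k1 k2 k3
    moreover have "X \<in> vector_fields A" "Y \<in> vector_fields A" "Z \<in> vector_fields A"
      using that by auto
    ultimately show ?thesis
      using koszul[of X Y Z k1 k2 k3 p] by simp
  qed
  \<comment> \<open>Fixing \<open>Z\<close> makes the formula a first-order rewrite rule.\<close>
  show "nab e1 e1 = frame_comb 0 0 0" "nab e1 e2 = frame_comb 0 0 ((\<alpha> - 2 * \<beta>) / 2)"
    "nab e1 e3 = frame_comb 0 ((\<alpha> - 2 * \<beta>) / 2) 0"
    "nab e2 e1 = frame_comb 0 (- \<gamma>) (\<alpha> / 2)" "nab e2 e2 = frame_comb \<gamma> 0 0"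
    "nab e2 e3 = frame_comb (\<alpha> / 2) 0 0"
    "nab e3 e1 = frame_comb 0 (\<alpha> / 2) \<gamma>" "nab e3 e2 = frame_comb (- \<alpha> / 2) 0 0"
    "nab e3 e3 = frame_comb \<gamma> 0 0"
    by (rule frame_comb_eqI; simp add: koszul'[where Z = e1] koszul'[where Z = e2]
        koszul'[where Z = e3] bracket_table metric_frame_comb; simp add: field_simps)+
qed

lemma nab_frame_comb:
  "nab (frame_comb x y z) (frame_comb x' y' z') = frame_comb
    (\<gamma> * y * y' + \<alpha> / 2 * y * z' - \<alpha> / 2 * z * y' + \<gamma> * z * z')
    ((\<alpha> - 2 * \<beta>) / 2 * x * z' - \<gamma> * y * x' + \<alpha> / 2 * z * x')
    ((\<alpha> - 2 * \<beta>) / 2 * x * y' + \<alpha> / 2 * y * x' + \<gamma> * z * x')"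
proof -
  have "nab (frame_comb x y z) (frame_comb x' y' z')
    = x *\<^sub>R (x' *\<^sub>R nab e1 e1 + y' *\<^sub>R nab e1 e2 + z' *\<^sub>R nab e1 e3)
    + y *\<^sub>R (x' *\<^sub>R nab e2 e1 + y' *\<^sub>R nab e2 e2 + z' *\<^sub>R nab e2 e3)
    + z *\<^sub>R (x' *\<^sub>R nab e3 e1 + y' *\<^sub>R nab e3 e2 + z' *\<^sub>R nab e3 e3)"
    unfolding frame_comb_def by (simp only: nab_add nab_scaleR vf_intros)
       (simp add: algebra_simps)
  also have "\<dots> = frame_comb
    (\<gamma> * y * y' + \<alpha> / 2 * y * z' - \<alpha> / 2 * z * y' + \<gamma> * z * z')
    ((\<alpha> - 2 * \<beta>) / 2 * x * z' - \<gamma> * y * x' + \<alpha> / 2 * z * x')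
    ((\<alpha> - 2 * \<beta>) / 2 * x * y' + \<alpha> / 2 * y * x' + \<gamma> * z * x')"
    unfolding nab_table frame_comb_linear
    by (intro frame_comb_cong) (simp_all add: field_simps)
  finally show ?thesis .
qed

lemma ricci_table:
  "Ric e1 e1 p = - (\<alpha>\<^sup>2 / 2 + 2 * \<gamma>\<^sup>2)" "Ric e1 e2 p = 0" "Ric e1 e3 p = 0"
  "Ric e2 e1 p = 0" "Ric e2 e2 p = \<alpha> * (\<alpha> - 2 * \<beta>) / 2" "Ric e2 e3 p = \<gamma> * (2 * \<beta> - \<alpha>)"
  "Ric e3 e1 p = 0" "Ric e3 e2 p = \<gamma> * (2 * \<beta> - \<alpha>)" "Ric e3 e3 p = - (\<alpha> * (\<alpha> - 2 * \<beta>) / 2)"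
proof -
  \<comment> \<open>Writing \<open>\<alpha> = 2 h\<close> clears all denominators, which leaves an identity of polynomials.\<close>
  obtain h where h: "\<alpha> = 2 * h" by (metis field_sum_of_halves mult_2)
  have half: "(2 * h - 2 * \<beta>) / 2 = h - \<beta>" "2 * h * (2 * h - 2 * \<beta>) / 2 = 2 * h * (h - \<beta>)"
    by (simp_all add: field_simps)
  have curv: "curvature nab X Y Z = nab X (nab Y Z) - nab Y (nab X Z) - nab (nab X Y - nab Y X) Z"
    if "X \<in> vector_fields A" "Y \<in> vector_fields A" for X Y Z
    using that by (simp add: curvature_def torsion_free)
  have Ric: "Ric X Y p = - g p (curvature nab X (frame_comb 1 0 0) Y p) (e1 p)
     - g p (curvature nab X (frame_comb 0 1 0) Y p) (e2 p)
     + g p (curvature nab X (frame_comb 0 0 1) Y p) (e3 p)" for X Y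
    by (simp only: ricci_def frame_eq_comb[symmetric])
  have R: "Ric (frame_comb x y z) (frame_comb x' y' z') p
    = - (\<alpha>\<^sup>2 / 2 + 2 * \<gamma>\<^sup>2) * x * x' + \<alpha> * (\<alpha> - 2 * \<beta>) / 2 * (y * y' - z * z')
      + \<gamma> * (2 * \<beta> - \<alpha>) * (y * z' + z * y')" for x y z x' y' z'
    by (simp only: Ric curv frame_comb_field nab_frame_comb frame_comb_linear metric_frame_comb)
       (simp only: h half power_mult_distrib, simp add: power2_eq_square algebra_simps)
  show "Ric e1 e1 p = - (\<alpha>\<^sup>2 / 2 + 2 * \<gamma>\<^sup>2)"
    using R[of 1 0 0 1 0 0, folded frame_eq_comb] by simp
  show "Ric e1 e2 p = 0"
    using R[of 1 0 0 0 1 0, folded frame_eq_comb] by simp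
  show "Ric e1 e3 p = 0"
    using R[of 1 0 0 0 0 1, folded frame_eq_comb] by simp
  show "Ric e2 e1 p = 0"
    using R[of 0 1 0 1 0 0, folded frame_eq_comb] by simp
  show "Ric e2 e2 p = \<alpha> * (\<alpha> - 2 * \<beta>) / 2"
    using R[of 0 1 0 0 1 0, folded frame_eq_comb] by simp
  show "Ric e2 e3 p = \<gamma> * (2 * \<beta> - \<alpha>)"
    using R[of 0 1 0 0 0 1, folded frame_eq_comb] by simp
  show "Ric e3 e1 p = 0"
    using R[of 0 0 1 1 0 0, folded frame_eq_comb] by simp
  show "Ric e3 e2 p = \<gamma> * (2 * \<beta> - \<alpha>)"
    using R[of 0 0 1 0 1 0, folded frame_eq_comb] by simp
  show "Ric e3 e3 p = - (\<alpha> * (\<alpha> - 2 * \<beta>) / 2)"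
    using R[of 0 0 1 0 0 1, folded frame_eq_comb] by simp
qed

end

section \<open>Quadratic equations for the Ricci operator of \<open>G\<^sub>2\<close>\<close>

text \<open>
  The eigenvalue argument in real terms: if \<open>c \<noteq> 0\<close>, eliminating \<open>l1 = - 2 b\<close> and \<open>l2\<close> leaves
  \<open>(a - b)\<^sup>2 + c\<^sup>2 = 0\<close>, which is impossible.
\<close>

lemma ricci_polynomial_iff:
  fixes \<alpha> \<beta> \<gamma> l1 l2 :: real
  defines "a \<equiv> - (\<alpha>\<^sup>2 / 2 + 2 * \<gamma>\<^sup>2)" and "b \<equiv> \<alpha> * (\<alpha> - 2 * \<beta>) / 2" and "c \<equiv> \<gamma> * (2 * \<beta> - \<alpha>)"
  assumes "\<gamma> \<noteq> 0"
  shows "a\<^sup>2 + l1 * a + l2 = 0 \<and> b\<^sup>2 - c\<^sup>2 + l1 * b + l2 = 0 \<and> c * (2 * b + l1) = 0 \<longleftrightarrow>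
    \<alpha> = 2 * \<beta> \<and> l1 = \<alpha>\<^sup>2 / 2 + 2 * \<gamma>\<^sup>2 \<and> l2 = 0" (is "?eqs \<longleftrightarrow> ?sol")
proof
  have "\<alpha>\<^sup>2 / 2 + 2 * \<gamma>\<^sup>2 > 0"
    using assms(4) by (intro add_nonneg_pos) auto
  then have a: "a \<noteq> 0" unfolding a_def by linarith
  assume eqs: ?eqs
  have c: "c = 0"
  proof (rule ccontr)
    assume "c \<noteq> 0"
    with eqs have l1: "l1 = - 2 * b" by simp
    with eqs have "(a - b)\<^sup>2 + c\<^sup>2 = 0"
      by (simp add: power2_eq_square algebra_simps)
    with \<open>c \<noteq> 0\<close> show False by (simp add: sum_power2_eq_zero_iff)
  qed
  then have \<alpha>: "\<alpha> = 2 * \<beta>" using assms(4) by (simp add: c_def)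
  then have "b = 0" by (simp add: b_def)
  with c eqs have "l2 = 0" by simp
  with eqs have "a * (a + l1) = 0" by (simp add: power2_eq_square algebra_simps)
  with a have "l1 = - a" by simp
  with \<alpha> \<open>l2 = 0\<close> show ?sol by (simp add: a_def)
next
  assume ?sol
  then have "l1 = - a" "l2 = 0" "b = 0" "c = 0" by (simp_all add: a_def b_def c_def)
  then show ?eqs by (simp add: power2_eq_square)
qed

theorem theorem2p5:
  fixes A :: "'a::{topological_group_add, t2_space, second_countable_topology} chart set"
    and g :: "'a tensor2"
    and nab :: "'a vector_field \<Rightarrow> 'a vector_field \<Rightarrow> 'a vector_field"
    and e1 e2 e3 :: "'a vector_field"
    and \<alpha> \<beta> \<gamma> l1 l2 :: real
  assumes "\<gamma> \<noteq> 0"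
    and "lie_group A"
    and "connected (UNIV :: 'a set)"
    and "simply_connected (UNIV :: 'a set)"
    and "lorentzian_metric A g"
    and "left_invariant_metric A g"
    and "levi_civita_connection A g nab"
    and "e1 \<in> lie_algebra A" "e2 \<in> lie_algebra A" "e3 \<in> lie_algebra A"
    and "independent {e1, e2, e3}"
    and "span {e1, e2, e3} = lie_algebra A"
    and "\<And>p. pseudo_orthonormal (g p) (e1 p) (e2 p) (e3 p)"
    and "lie_bracket e1 e2 = \<gamma> *\<^sub>R e2 - \<beta> *\<^sub>R e3"
    and "lie_bracket e1 e3 = - \<beta> *\<^sub>R e2 - \<gamma> *\<^sub>R e3"
    and "lie_bracket e2 e3 = \<alpha> *\<^sub>R e1"
  shows "Ein2 A g nab e1 e2 e3 l1 l2 \<longleftrightarrow>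
    \<alpha> = 2 * \<beta> \<and> \<gamma> \<noteq> 0 \<and> l1 = \<alpha>\<^sup>2 / 2 + 2 * \<gamma>\<^sup>2 \<and> l2 = 0"
proof -
  interpret G2_frame A g nab e1 e2 e3 \<alpha> \<beta> \<gamma>
    using assms by unfold_locales (auto simp: lie_group_def lie_algebra_def)
  show ?thesis
    using \<open>\<gamma> \<noteq> 0\<close> unfolding Ein2_iff[OF ricci_table] ricci_polynomial_iff[OF \<open>\<gamma> \<noteq> 0\<close>] by simp
qed

end
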